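(* Let $h:\mathbb{R}^d\to\mathbb{R}$ be locally ACL and continuous, and let $q(z)=\mathcal{N}(z\mid\mu,\Sigma)$ be a multivariate Gaussian distribution with mean $\mu\in\mathbb{R}^d$ and symmetric positive definite covariance matrix $\Sigma\in\mathbb{R}^{d\times d}$. Assume $\mathbb{E}_q[h(z)]$, $\mathbb{E}_q[\nabla_zh(z)]$ and $\mathbb{E}_q[\Sigma^{-1}(z-\mu)h(z)]$ are well-defined, and that differentiation and integration may be interchanged, i.e. $\nabla_\mu\mathbb{E}_q[h(z)]=\mathbb{E}_q\big[h(z)\frac{\nabla_\mu q(z)}{q(z)}\big]$. Then $$\nabla_\mu\mathbb{E}_q[h(z)]=\mathbb{E}_q[\nabla_zh(z)]=\mathbb{E}_q\big[\Sigma^{-1}(z-\mu)h(z)\big].$$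
   Context: An expectation $\mathbb{E}_q[g]$ is called well-defined if $\mathbb{E}_q[\|g\|]<\infty$ (Euclidean norm). A function $g:[a,b]\to\mathbb{R}^m$ is absolutely continuous (AC) if its derivative exists almost everywhere on $[a,b]$, is Lebesgue integrable, and $g(x)=g(a)+\int_a^x g'(t)\,dt$ for all $x\in[a,b]$. A function $g:\mathbb{R}\to\mathbb{R}^m$ is locally AC if it is AC on every compact interval. A function $h:\mathbb{R}^d\to\mathbb{R}^m$ is locally ACL if for every $i$ and almost every $z_{-i}\in\mathbb{R}^{d-1}$ (all coordinates except the $i$-th), the function $z_i\mapsto h(z_i,z_{-i})$ is locally AC. $\nabla_zh$ is the column vector of partial derivatives, existing almost everywhere. *)

theory Defs
  imports "HOL-Analysis.Analysis"
begin

text \<open>The one-sided derivative at the endpoints is immaterial (null set). At points of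
  non-differentiability \<open>vector_derivative\<close> is an unspecified value, which is harmless because
  these points form a null set and \<open>lebesgue\<close> is complete.\<close>

definition abs_continuous_on_interval ::
    "real \<Rightarrow> real \<Rightarrow> (real \<Rightarrow> 'm::euclidean_space) \<Rightarrow> bool" where
  "abs_continuous_on_interval a b g \<longleftrightarrow>
     (AE t in lebesgue. t \<in> {a..b} \<longrightarrow> g differentiable (at t within {a..b})) \<and>
     (\<lambda>t. vector_derivative g (at t within {a..b})) absolutely_integrable_on {a..b} \<and>
     (\<forall>x\<in>{a..b}. g x = g a +
        (LINT t:{a..x}|lebesgue. vector_derivative g (at t within {a..b})))"

definition locally_AC :: "(real \<Rightarrow> 'm::euclidean_space) \<Rightarrow> bool" where
  "locally_AC g \<longleftrightarrow> (\<forall>a b. a \<le> b \<longrightarrow> abs_continuous_on_interval a b g)"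

definition vec_upd :: "real ^ 'd \<Rightarrow> 'd \<Rightarrow> real \<Rightarrow> real ^ 'd" where
  "vec_upd z i t = (\<chi> j. if j = i then t else z $ j)"

text \<open>The remaining coordinates \<open>w\<close> range over the product of one-dimensional Lebesgue measures
  indexed by \<open>UNIV - {i}\<close>, i.e. over \<open>(d-1)\<close>-dimensional space (a one-point space of mass 1 if
  \<open>d = 1\<close>). Passing to the completion of this measure would not change the almost-everywhere
  quantifier.\<close>

definition locally_ACL :: "(real ^ 'd \<Rightarrow> 'm::euclidean_space) \<Rightarrow> bool" where
  "locally_ACL h \<longleftrightarrow>
     (\<forall>i. AE w in PiM (UNIV - {i}) (\<lambda>_. lborel).
        locally_AC (\<lambda>t. h (\<chi> j. if j = i then t else w j)))"

text \<open>Gradients are vectors of partial derivatives; total differentiability is not required.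
  A component of \<open>grad f z\<close> is unspecified if the corresponding partial derivative does not
  exist, whereas \<open>has_grad\<close> asserts existence of all of them.\<close>

definition grad :: "(real ^ 'd \<Rightarrow> real) \<Rightarrow> real ^ 'd \<Rightarrow> real ^ 'd" where
  "grad f z = (\<chi> i. deriv (\<lambda>t. f (vec_upd z i t)) (z $ i))"

definition has_grad :: "(real ^ 'd \<Rightarrow> real) \<Rightarrow> real ^ 'd \<Rightarrow> real ^ 'd \<Rightarrow> bool" where
  "has_grad f z G \<longleftrightarrow>
     (\<forall>i. ((\<lambda>t. f (vec_upd z i t)) has_real_derivative G $ i) (at (z $ i)))"

definition sym_pos_def :: "real ^ 'd ^ 'd \<Rightarrow> bool" where
  "sym_pos_def A \<longleftrightarrow> transpose A = A \<and> (\<forall>x. x \<noteq> 0 \<longrightarrow> 0 < x \<bullet> (A *v x))"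

definition gaussian_density :: "real ^ 'd \<Rightarrow> real ^ 'd ^ 'd \<Rightarrow> real ^ 'd \<Rightarrow> real" where
  "gaussian_density \<mu> \<Sigma> z =
     exp (- ((z - \<mu>) \<bullet> (matrix_inv \<Sigma> *v (z - \<mu>))) / 2) / sqrt ((2 * pi) ^ CARD('d) * det \<Sigma>)"

definition gaussian :: "real ^ 'd \<Rightarrow> real ^ 'd ^ 'd \<Rightarrow> (real ^ 'd) measure" where
  "gaussian \<mu> \<Sigma> = density lborel (\<lambda>z. ennreal (gaussian_density \<mu> \<Sigma> z))"

end

theory Submission
  imports Defs
begin

text \<open>The interchange hypothesis already expresses the gradient as the expectation of \<open>h\<close> times
  the score \<open>matrix_inv \<Sigma> *v (z - \<mu>)\<close>, so everything reduces to Stein's identity,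
  which says that the partial derivatives of \<open>h q\<close> have integral zero. By Fubini it is enough to integrate over almost every
  line parallel to a coordinate axis. On such a line \<open>h q\<close> and its derivative are integrable and
  \<open>h q\<close> is locally absolutely continuous, so that the integral of the derivative vanishes.\<close>

section \<open>Integration of absolutely continuous functions on the line\<close>

text \<open>The integral of \<open>v (x + 1) - v x\<close> vanishes by translation invariance. It also equals the
  integral of \<open>g\<close>: each \<open>t\<close> lies in \<open>{x..x + 1}\<close> for a set of \<open>x\<close> of measure 1.\<close>

lemma integral_deriv_whole_line_eq_0:
  fixes v g :: "real \<Rightarrow> real"
  assumes v: "integrable lborel v" and g: "integrable lborel g"
    and FTC: "\<And>a b. a \<le> b \<Longrightarrow> v b - v a = (LINT t:{a..b}|lborel. g t)"
  shows "integral\<^sup>L lborel g = 0"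
proof -
  define k :: "real \<Rightarrow> real \<Rightarrow> real" where "k = (\<lambda>t x. if x \<le> t \<and> t \<le> x + 1 then g t else 0)"
  have [measurable]: "g \<in> borel_measurable borel" using g by auto
  \<comment> \<open>The kernel is cut out by a unit interval in either variable:
    \<open>{t - 1..t}\<close> for fixed \<open>t\<close>, \<open>{x..x + 1}\<close> for fixed
    \<open>x\<close>.\<close>
  have k_ind: "k t = (\<lambda>x. indicator {t - 1..t} x *\<^sub>R g t)"
    and k_ind': "(\<lambda>t. k t x) = (\<lambda>t. indicator {x..x + 1} t *\<^sub>R g t)" for t x
    by (auto simp: k_def fun_eq_iff)
  have kt: "integrable lborel (k t)" "(LINT x|lborel. k t x) = g t" for t
    unfolding k_ind by simp_all
  \<comment> \<open>Since that interval has length 1, the absolute sections integrate to the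
    integrable function \<open>\<bar>g t\<bar>\<close>, which is what Fubini requires of
    \<open>k\<close>.\<close>
  have norm_kt: "(LINT x|lborel. norm (k t x)) = \<bar>g t\<bar>" for t
  proof -
    have "(\<lambda>x. norm (k t x)) = (\<lambda>x. indicator {t - 1..t} x *\<^sub>R \<bar>g t\<bar>)"
      by (auto simp: k_def fun_eq_iff)
    then show ?thesis by simp
  qed
  have "integrable (lborel \<Otimes>\<^sub>M lborel) (case_prod k)"
  proof (rule lborel_pair.Fubini_integrable)
    show "case_prod k \<in> borel_measurable (lborel \<Otimes>\<^sub>M lborel)"
      by (simp add: k_def case_prod_beta')
    show "integrable lborel (\<lambda>t. LINT x|lborel. norm (case (t, x) of (t, x) \<Rightarrow> k t x))"
      using g by (simp only: prod.case norm_kt integrable_abs)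
    show "AE t in lborel. integrable lborel (\<lambda>x. case (t, x) of (t, x) \<Rightarrow> k t x)"
      using kt(1) by (simp only: prod.case AE_I2)
  qed
  from lborel_pair.Fubini_integral[OF this]
  have "(LINT x|lborel. LINT t|lborel. k t x) = integral\<^sup>L lborel g"
    by (simp add: kt)
  moreover have "(LINT t|lborel. k t x) = v (1 + x) - v x" for x
    using FTC[of x "x + 1"] by (simp add: k_ind' set_lebesgue_integral_def add.commute)
  moreover have "(LINT x|lborel. v (1 + x) - v x) = 0"
  proof -
    have "integrable lborel (\<lambda>x. v (1 + x))"
      using lborel_integrable_real_affine[OF v, of 1 1] by simp
    moreover have "(LINT x|lborel. v (1 + x)) = integral\<^sup>L lborel v"
      using lborel_integral_real_affine[of 1 v 1] by simp
    ultimately show ?thesis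
      using v by simp
  qed
  ultimately show ?thesis by simp
qed

text \<open>Fubini on the square \<open>{a..b} \<times> {a..b}\<close>, cut along the diagonal into the supports of the
  kernels \<open>A\<close> and \<open>B\<close>.\<close>

lemma set_integral_by_parts:
  fixes f g u p :: "real \<Rightarrow> real"
  assumes f: "set_integrable lborel {a..b} f" and g: "set_integrable lborel {a..b} g"
    and u: "\<And>x. x \<in> {a..b} \<Longrightarrow> u x = u a + (LINT t:{a..x}|lborel. f t)"
    and p: "\<And>x. x \<in> {a..b} \<Longrightarrow> p x = p a + (LINT t:{a..x}|lborel. g t)"
    and "a \<le> b"
  shows "(LINT t:{a..b}|lborel. f t * p t + u t * g t) = u b * p b - u a * p a"
proof -
  \<comment> \<open>Extension by zero turns the square into the whole plane and yields Borel
    measurable integrands.\<close>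
  define F where "F = (\<lambda>x. indicator {a..b} x * f x)"
  define G where "G = (\<lambda>x. indicator {a..b} x * g x)"
  have F: "integrable lborel F" and G: "integrable lborel G"
    using f g by (auto simp: F_def G_def set_integrable_def)
  then have [measurable]: "F \<in> borel_measurable borel" "G \<in> borel_measurable borel"
    by auto
  have FG: "integrable (lborel \<Otimes>\<^sub>M lborel) (\<lambda>(x, y). F x * G y)"
    by (rule lborel_pair.Fubini_integrable) (use F G in \<open>simp_all add: abs_mult\<close>)
  \<comment> \<open>The diagonal is given to \<open>A\<close> alone, so that \<open>A\<close> and
    \<open>B\<close> add up to \<open>F x * G y\<close> at every point.\<close>
  define A where "A = (\<lambda>x y. if y \<le> x then F x * G y else 0)"
  define B where "B = (\<lambda>x y. if x < y then F x * G y else 0)"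
  have A: "integrable (lborel \<Otimes>\<^sub>M lborel) (case_prod A)"
    by (rule Bochner_Integration.integrable_bound[OF FG]) (auto simp: A_def)
  have B: "integrable (lborel \<Otimes>\<^sub>M lborel) (case_prod B)"
    by (rule Bochner_Integration.integrable_bound[OF FG]) (auto simp: B_def)
  have A_inner: "(LINT y|lborel. A x y) = F x * (p x - p a)" for x
  proof (cases "x \<in> {a..b}")
    case True
    have "A x = (\<lambda>y. F x * (indicator {a..x} y *\<^sub>R g y))"
      using True by (auto simp: A_def G_def fun_eq_iff indicator_def)
    then show ?thesis
      using p[OF True] by (simp add: set_lebesgue_integral_def)
  next
    case False
    then have "F x = 0" by (simp add: F_def)
    then show ?thesis by (simp add: A_def cong: if_cong)
  qed
  have B_inner: "(LINT x|lborel. B x y) = G y * (u y - u a)" for y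
  proof (cases "y \<in> {a..b}")
    case True
    \<comment> \<open>The strict inequality in \<open>B\<close> leaves out \<open>x = y\<close>,
      whereas \<open>{a..y}\<close> contains it: the integrands differ at most at this one
      point.\<close>
    have "(LINT x|lborel. B x y) = (LINT x|lborel. G y * (indicator {a..y} x *\<^sub>R f x))"
    proof (rule integral_cong_AE)
      \<comment> \<open>Only the zero extension \<open>F\<close> is known to be measurable on the
        whole line, so \<open>f\<close> is replaced by \<open>F\<close> inside
        \<open>{a..y}\<close>.\<close>
      have eq: "(\<lambda>x. G y * (indicator {a..y} x *\<^sub>R f x)) = (\<lambda>x. G y * (indicator {a..y} x * F x))"
        using True by (auto simp: F_def fun_eq_iff indicator_def)
      show "(\<lambda>x. G y * (indicator {a..y} x *\<^sub>R f x)) \<in> borel_measurable lborel"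
        unfolding eq by simp
      show "AE x in lborel. B x y = G y * (indicator {a..y} x *\<^sub>R f x)"
        using AE_lborel_singleton[of y] by eventually_elim
          (use True in \<open>auto simp: B_def F_def indicator_def\<close>)
    qed (simp add: B_def)
    then show ?thesis
      using u[OF True] by (simp add: set_lebesgue_integral_def)
  next
    case False
    then have "G y = 0" by (simp add: G_def)
    then show ?thesis by (simp add: B_def cong: if_cong)
  qed
  \<comment> \<open>\<open>A\<close> is integrated over \<open>y\<close> first and \<open>B\<close>
    over \<open>x\<close> first; the two triangles together give the integral over the square, which
    factorises.\<close>
  have "(LINT t|lborel. F t * (p t - p a)) + (LINT t|lborel. G t * (u t - u a)) =
    integral\<^sup>L (lborel \<Otimes>\<^sub>M lborel) (case_prod A) + integral\<^sup>L (lborel \<Otimes>\<^sub>M lborel) (case_prod B)"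
    using lborel_pair.integral_fst[OF A] lborel_pair.integral_snd[OF B] by (simp add: A_inner B_inner)
  also have "\<dots> = integral\<^sup>L (lborel \<Otimes>\<^sub>M lborel) (\<lambda>(x, y). F x * G y)"
  proof -
    have "(\<lambda>(x, y). F x * G y) = (\<lambda>z. case_prod A z + case_prod B z)"
      by (auto simp: A_def B_def)
    then show ?thesis using A B by simp
  qed
  also have "\<dots> = integral\<^sup>L lborel F * integral\<^sup>L lborel G"
    using lborel_pair.integral_fst[OF FG] by simp
  finally have square: "(LINT t|lborel. F t * (p t - p a)) + (LINT t|lborel. G t * (u t - u a)) =
    integral\<^sup>L lborel F * integral\<^sup>L lborel G" .
  have Fp: "integrable lborel (\<lambda>t. F t * (p t - p a))"
    using lborel_pair.integrable_fst[OF A] by (simp add: A_inner)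
  have Gu: "integrable lborel (\<lambda>t. G t * (u t - u a))"
    using lborel_pair.integrable_snd[OF B] by (simp add: B_inner)
  \<comment> \<open>Splitting \<open>p t\<close> as \<open>(p t - p a) + p a\<close>, and
    \<open>u t\<close> likewise, leaves the triangle integrals and constant multiples of the
    integrals of \<open>F\<close> and \<open>G\<close>.\<close>
  have "(LINT t:{a..b}|lborel. f t * p t + u t * g t) =
    (LINT t|lborel. (F t * (p t - p a) + G t * (u t - u a)) + (p a * F t + u a * G t))"
    by (auto simp: set_lebesgue_integral_def F_def G_def algebra_simps intro!: Bochner_Integration.integral_cong)
  also have "\<dots> = integral\<^sup>L lborel F * integral\<^sup>L lborel G + (p a * integral\<^sup>L lborel F + u a * integral\<^sup>L lborel G)"
    using F G Fp Gu square by simp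
  finally have parts: "(LINT t:{a..b}|lborel. f t * p t + u t * g t) = integral\<^sup>L lborel F * integral\<^sup>L lborel G +
      (p a * integral\<^sup>L lborel F + u a * integral\<^sup>L lborel G)" .
  have FG_eq: "integral\<^sup>L lborel F = u b - u a" "integral\<^sup>L lborel G = p b - p a"
    using u[of b] p[of b] \<open>a \<le> b\<close> by (simp_all add: F_def G_def set_lebesgue_integral_def)
  show ?thesis unfolding parts FG_eq by (simp add: algebra_simps)
qed

text \<open>Bridge from the definition, with its derivative within the interval and its completed
  measure, to \<open>deriv\<close> and \<open>lborel\<close>, where Fubini is applied. The two
  derivatives agree almost everywhere, and Borel measurability of \<open>deriv u\<close> allows
  passing from the completion back to \<open>lborel\<close>.\<close>

lemma AC_deriv:
  fixes u :: "real \<Rightarrow> real"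
  assumes AC: "abs_continuous_on_interval a b u" and [measurable]: "deriv u \<in> borel_measurable borel"
  shows "set_integrable lborel {a..b} (deriv u)"
    and "\<And>x. x \<in> {a..b} \<Longrightarrow> u x = u a + (LINT t:{a..x}|lborel. deriv u t)"
proof -
  let ?D = "\<lambda>t. vector_derivative u (at t within {a..b})"
  have D: "set_integrable lebesgue {a..b} ?D"
    and u: "\<And>x. x \<in> {a..b} \<Longrightarrow> u x = u a + (LINT t:{a..x}|lebesgue. ?D t)"
    using AC unfolding abs_continuous_on_interval_def by blast+
  have "AE t in lebesgue. t \<in> {a..b} \<longrightarrow> u differentiable (at t within {a..b})"
    using AC unfolding abs_continuous_on_interval_def by blast
  \<comment> \<open>At the endpoints the derivative within the interval is one-sided; in the
    interior it is the ordinary one.\<close>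
  moreover have "AE t in lebesgue. t \<noteq> a" "AE t in lebesgue. t \<noteq> b"
    by (rule AE_completion[OF AE_lborel_singleton])+
  ultimately have eq: "AE t in lebesgue. t \<in> {a..b} \<longrightarrow> ?D t = deriv u t"
  proof eventually_elim
    case (elim t)
    show ?case
    proof
      assume "t \<in> {a..b}"
      with elim have "at t within {a..b} = at t"
        by (intro at_within_interior) (auto simp: interior_atLeastAtMost_real)
      with elim \<open>t \<in> {a..b}\<close> obtain d where d: "(u has_real_derivative d) (at t)"
        by (auto simp: real_differentiable_def)
      then have "vector_derivative u (at t) = d"
        by (simp add: has_real_derivative_iff_has_vector_derivative vector_derivative_at)
      with d show "?D t = deriv u t"
        by (simp add: \<open>at t within {a..b} = at t\<close> DERIV_imp_deriv)
    qed
  qed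
  have meas: "(\<lambda>t. indicator {a..x} t *\<^sub>R deriv u t) \<in> borel_measurable lborel" for x
    by simp
  have meas': "(\<lambda>t. indicator {a..x} t *\<^sub>R deriv u t) \<in> borel_measurable lebesgue" for x
    by (rule measurable_completion[OF meas])
  have Dm: "(\<lambda>t. indicator {a..x} t *\<^sub>R ?D t) \<in> borel_measurable lebesgue" if "x \<in> {a..b}" for x
  proof -
    have "set_integrable lebesgue {a..x} ?D"
      by (rule set_integrable_subset[OF D]) (use that in auto)
    then show ?thesis by (auto simp: set_integrable_def)
  qed
  have "integrable lebesgue (\<lambda>t. indicator {a..b} t *\<^sub>R deriv u t)"
    by (rule Bochner_Integration.integrable_cong_AE_imp[OF D[unfolded set_integrable_def] meas'])
      (use eq in \<open>eventually_elim, auto simp: indicator_def\<close>)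
  then show "set_integrable lborel {a..b} (deriv u)"
    unfolding set_integrable_def by (rule integrable_completion[OF meas, THEN iffD1])
  show "u x = u a + (LINT t:{a..x}|lborel. deriv u t)" if x: "x \<in> {a..b}" for x
  proof -
    have "(LINT t:{a..x}|lebesgue. ?D t) = (LINT t:{a..x}|lebesgue. deriv u t)"
      unfolding set_lebesgue_integral_def
      by (rule integral_cong_AE[OF Dm[OF x] meas'])
         (use eq in \<open>eventually_elim, use x in \<open>auto simp: indicator_def\<close>\<close>)
    also have "\<dots> = (LINT t:{a..x}|lborel. deriv u t)"
      unfolding set_lebesgue_integral_def by (rule integral_completion[OF meas])
    finally show ?thesis using u[OF x] by simp
  qed
qed

section \<open>Fubini along lines parallel to a coordinate axis\<close>

lemma measurable_coordinate:
  fixes i :: "'d::finite"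
  shows "(\<lambda>(t, w). (\<chi> j. if j = i then t else w j) :: real ^ 'd)
    \<in> measurable (lborel \<Otimes>\<^sub>M PiM (UNIV - {i}) (\<lambda>_. lborel)) borel" (is "?E \<in> measurable (_ \<Otimes>\<^sub>M ?N) _")
proof (rule borel_measurable_euclidean_space[THEN iffD2], rule ballI)
  fix b :: "real ^ 'd" assume "b \<in> Basis"
  then obtain j where b: "b = axis j 1" by (auto simp: Basis_vec_def)
  have eq: "?E x \<bullet> b = (if j = i then fst x else snd x j)" for x
    by (simp add: b inner_axis case_prod_beta')
  show "(\<lambda>x. ?E x \<bullet> b) \<in> borel_measurable (lborel \<Otimes>\<^sub>M ?N)"
  proof (cases "j = i")
    case True
    then show ?thesis by (simp add: eq)
  next
    case False
    have "(\<lambda>w. w j) \<in> measurable ?N lborel"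
      by (rule measurable_component_singleton) (simp add: False)
    from measurable_compose[OF measurable_snd this] show ?thesis
      by (simp add: eq False)
  qed
qed

text \<open>The null sets in \<open>locally_ACL\<close> belong to the product over
  \<open>UNIV - {i}\<close>, so Fubini is needed for exactly this splitting. Lebesgue measure is
  determined by its values on boxes, and the volume of a box splits off the side length in
  coordinate \<open>i\<close>.\<close>

lemma lborel_eq_distr_coordinate:
  fixes i :: "'d::finite"
  shows "lborel = distr (lborel \<Otimes>\<^sub>M PiM (UNIV - {i}) (\<lambda>_. lborel)) borel
    (\<lambda>(t, w). (\<chi> j. if j = i then t else w j) :: real ^ 'd)"
proof (rule lborel_eqI)
  interpret product_sigma_finite "\<lambda>_ :: 'd. lborel :: real measure" ..
  let ?N = "PiM (UNIV - {i}) (\<lambda>_. lborel :: real measure)"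
  let ?E = "\<lambda>(t, w). (\<chi> j. if j = i then t else w j) :: real ^ 'd"
  interpret N: sigma_finite_measure ?N by (rule sigma_finite) simp
  note meas = measurable_coordinate[of i]
  fix l u :: "real ^ 'd"
  assume "\<And>b. b \<in> Basis \<Longrightarrow> l \<bullet> b \<le> u \<bullet> b"
  from this[of "axis j 1" for j] have lu: "l $ j \<le> u $ j" for j
    by (simp add: inner_axis axis_in_Basis_iff)
  \<comment> \<open>The bounds on coordinate \<open>i\<close> constrain \<open>t\<close>, the others
    constrain \<open>w\<close>; the extensionality demanded by \<open>\<Pi>\<^sub>E\<close> comes
    from \<open>w\<close> lying in the space of the product measure.\<close>
  have vimage: "?E -` box l u \<inter> space (lborel \<Otimes>\<^sub>M ?N) =
      {l $ i<..<u $ i} \<times> (\<Pi>\<^sub>E j\<in>UNIV - {i}. {l $ j<..<u $ j})"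
  proof -
    have "(\<forall>j. l $ j < (if j = i then t else w j) \<and> (if j = i then t else w j) < u $ j) \<longleftrightarrow>
        (l $ i < t \<and> t < u $ i) \<and> (\<forall>j. j \<noteq> i \<longrightarrow> l $ j < w j \<and> w j < u $ j)" for t w
      by auto
    then have "(t, w) \<in> ?E -` box l u \<inter> space (lborel \<Otimes>\<^sub>M ?N) \<longleftrightarrow>
        (t, w) \<in> {l $ i<..<u $ i} \<times> (\<Pi>\<^sub>E j\<in>UNIV - {i}. {l $ j<..<u $ j})" for t w
      by (auto simp: mem_box_cart PiE_iff space_pair_measure space_PiM)
    from this[of "fst x" "snd x" for x] show ?thesis
      unfolding prod.collapse by (rule set_eqI)
  qed
  have "emeasure (distr (lborel \<Otimes>\<^sub>M ?N) borel ?E) (box l u) =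
      emeasure lborel {l $ i<..<u $ i} * emeasure ?N (\<Pi>\<^sub>E j\<in>UNIV - {i}. {l $ j<..<u $ j})"
    unfolding emeasure_distr[OF meas borel_open[OF open_box]] vimage
    by (rule N.emeasure_pair_measure_Times) (auto intro!: sets_PiM_I_finite)
  also have "\<dots> = ennreal (u $ i - l $ i) * (\<Prod>j\<in>UNIV - {i}. ennreal (u $ j - l $ j))"
    using lu by (subst emeasure_PiM) auto
  also have "\<dots> = (\<Prod>j\<in>UNIV. ennreal (u $ j - l $ j))"
    by (subst prod.remove[of UNIV i]) auto
  also have "\<dots> = ennreal (\<Prod>j\<in>UNIV. (u - l) \<bullet> axis j 1)"
    using lu by (simp add: prod_ennreal inner_axis)
  also have "(\<Prod>j\<in>UNIV. (u - l) \<bullet> axis j 1) = (\<Prod>b\<in>Basis. (u - l) \<bullet> b)"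
    by (rule prod.reindex_bij_betw)
      (auto simp: bij_betw_def inj_on_def axis_eq_axis Basis_vec_def)
  finally show "emeasure (distr (lborel \<Otimes>\<^sub>M ?N) borel ?E) (box l u) = (\<Prod>b\<in>Basis. (u - l) \<bullet> b)" .
qed simp

text \<open>In the application \<open>p\<close> is the Gaussian density. On almost every line
  \<open>h\<close> is locally absolutely continuous and \<open>p\<close> is continuously
  differentiable, so integration by parts shows that the integrand integrates to the increments of
  \<open>h * p\<close>.\<close>

lemma integral_partial_derivative_product_eq_0:
  fixes h p p' :: "real ^ 'd \<Rightarrow> real"
  assumes ACL: "locally_ACL h" and grad_meas: "grad h \<in> borel_measurable borel"
    and p: "\<And>z. ((\<lambda>t. p (vec_upd z i t)) has_real_derivative p' z) (at (z $ i))"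
    and p': "continuous_on UNIV p'"
    and hp: "integrable lborel (\<lambda>z. h z * p z)"
    and J: "integrable lborel (\<lambda>z. grad h z $ i * p z + h z * p' z)"
  shows "(LINT z|lborel. grad h z $ i * p z + h z * p' z) = 0"
proof -
  interpret product_sigma_finite "\<lambda>_ :: 'd. lborel :: real measure" ..
  let ?N = "PiM (UNIV - {i}) (\<lambda>_. lborel :: real measure)"
  define E where "E = (\<lambda>t w. (\<chi> j. if j = i then t else w j) :: real ^ 'd)"
  let ?J = "\<lambda>z. grad h z $ i * p z + h z * p' z"
  interpret N: sigma_finite_measure ?N by (rule sigma_finite) simp
  interpret P: pair_sigma_finite lborel ?N ..
  have lborel_eq: "lborel = distr (lborel \<Otimes>\<^sub>M ?N) borel (case_prod E)"
    unfolding E_def by (rule lborel_eq_distr_coordinate)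
  have E [measurable]: "case_prod E \<in> measurable (lborel \<Otimes>\<^sub>M ?N) borel"
    unfolding E_def by (rule measurable_coordinate)
  have int_E: "integrable (lborel \<Otimes>\<^sub>M ?N) (\<lambda>(t, w). f (E t w))" if "integrable lborel f" for f :: "_ \<Rightarrow> real"
    using integrable_distr[OF E, folded lborel_eq, OF that] by (simp add: case_prod_beta')
  \<comment> \<open>Overwriting coordinate \<open>i\<close> only moves along the line given by
    \<open>w\<close>, so partial derivatives at \<open>E t w\<close> are derivatives of sections at
    \<open>t\<close>.\<close>
  have slice_upd: "vec_upd (E t w) i s = E s w" and slice_nth: "E t w $ i = t" for s t w
    by (auto simp: E_def vec_upd_def vec_eq_iff)
  have AC_E: "AE w in ?N. locally_AC (\<lambda>t. h (E t w))"
    using ACL unfolding locally_ACL_def E_def by (rule spec)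
  \<comment> \<open>Almost every \<open>w\<close> has integrable sections and a locally absolutely
    continuous section of \<open>h\<close>. \<open>AE_space\<close> adds that \<open>w\<close> lies
    in the space of \<open>?N\<close>, from which the section map is measurable.\<close>
  have "AE w in ?N. (LINT t|lborel. ?J (E t w)) = 0"
    using P.AE_integrable_snd[OF int_E[OF hp]] P.AE_integrable_snd[OF int_E[OF J]]
      AC_E AE_space
  proof eventually_elim
    case (elim w)
    let ?u = "\<lambda>t. h (E t w)" and ?p = "\<lambda>t. p (E t w)" and ?p' = "\<lambda>t. p' (E t w)"
    have E_w [measurable]: "(\<lambda>t. E t w) \<in> measurable borel borel"
      using measurable_compose[OF measurable_Pair2'[OF elim(4)] E] by simp
    \<comment> \<open>Both sides unfold to the same \<open>deriv\<close> term, so they agree even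
      where no derivative exists.\<close>
    have du: "deriv ?u = (\<lambda>t. grad h (E t w) $ i)"
      by (simp add: grad_def slice_upd slice_nth)
    have du_meas: "deriv ?u \<in> borel_measurable borel"
      unfolding du
      by (rule measurable_compose[OF E_w measurable_compose[OF grad_meas
            borel_measurable_continuous_onI[OF linear_continuous_on[OF bounded_linear_vec_nth]]]])
    have dp: "(?p has_real_derivative ?p' t) (at t)" for t
      using p[of "E t w"] by (simp add: slice_upd slice_nth)
    have cont_E: "continuous_on A (\<lambda>t. E t w)" for A
    proof -
      have "continuous_on A (\<lambda>t. if j = i then t else w j)" for j
        by (cases "j = i") simp_all
      then show ?thesis
        unfolding E_def by (intro continuous_on_vec_lambda)
    qed
    have cont: "continuous_on A ?p'" for A
      by (rule continuous_on_compose2[OF p' cont_E]) auto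
    have FTC_p: "?p b = ?p a + (LINT t:{a..b}|lborel. ?p' t)" if "a \<le> b" for a b
      using integral_FTC_atLeastAtMost[OF that _ cont, of ?p] dp
      by (simp add: set_lebesgue_integral_def has_real_derivative_iff_has_vector_derivative
            has_vector_derivative_at_within)
    have "?u b * ?p b - ?u a * ?p a = (LINT t:{a..b}|lborel. ?J (E t w))" if "a \<le> b" for a b
    proof -
      have AC: "abs_continuous_on_interval a b ?u"
        using elim(3) that unfolding locally_AC_def by simp
      have "(LINT t:{a..b}|lborel. deriv ?u t * ?p t + ?u t * ?p' t) = ?u b * ?p b - ?u a * ?p a"
      proof (rule set_integral_by_parts[of a b "deriv ?u" ?p' ?u ?p])
        show "set_integrable lborel {a..b} (deriv ?u)"
          by (rule AC_deriv(1)[OF AC du_meas])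
        show "set_integrable lborel {a..b} ?p'"
          by (rule borel_integrable_atLeastAtMost'[OF cont])
        show "?u x = ?u a + (LINT t:{a..x}|lborel. deriv ?u t)" if "x \<in> {a..b}" for x
          by (rule AC_deriv(2)[OF AC du_meas that])
        show "?p x = ?p a + (LINT t:{a..x}|lborel. ?p' t)" if "x \<in> {a..b}" for x
          by (rule FTC_p) (use that in simp)
      qed (rule \<open>a \<le> b\<close>)
      then show ?thesis
        unfolding du by (rule sym)
    qed
    then show ?case
      by (rule integral_deriv_whole_line_eq_0[OF elim(1,2)])
  qed
  then have "(LINT w|?N. LINT t|lborel. ?J (E t w)) = 0"
    by (rule integral_eq_zero_AE)
  moreover have "integral\<^sup>L lborel ?J = integral\<^sup>L (lborel \<Otimes>\<^sub>M ?N) (\<lambda>(t, w). ?J (E t w))"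
    using integral_distr[OF E, of ?J, folded lborel_eq] borel_measurable_integrable[OF J]
    by (simp add: case_prod_beta')
  ultimately show ?thesis
    using P.integral_snd[OF int_E[OF J]] by simp
qed

section \<open>Symmetric positive definite matrices\<close>

lemma sym_pos_def_invertible:
  fixes A :: "real ^ 'd ^ 'd"
  assumes "sym_pos_def A"
  shows "invertible A"
proof -
  have "x = 0" if "A *v x = 0" for x
    using assms that by (force simp: sym_pos_def_def)
  then show ?thesis
    by (simp add: invertible_left_inverse matrix_left_invertible_ker)
qed

text \<open>The segment from the identity to \<open>A\<close> consists of positive definite, hence invertible,
  matrices, so \<open>det\<close> cannot change sign along it.\<close>

lemma sym_pos_def_det_pos:
  fixes A :: "real ^ 'd ^ 'd"
  assumes A: "sym_pos_def A"
  shows "det A > 0"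
proof (rule ccontr)
  define B where "B = (\<lambda>t. (1 - t) *\<^sub>R mat 1 + t *\<^sub>R A)"
  have B: "sym_pos_def (B t)" if "0 \<le> t" "t \<le> 1" for t
    unfolding sym_pos_def_def
  proof (intro conjI allI impI)
    have "transpose (B t) = (1 - t) *\<^sub>R mat 1 + t *\<^sub>R transpose A"
      by (simp add: B_def transpose_def mat_def vec_eq_iff)
    then show "transpose (B t) = B t"
      using A by (simp add: B_def sym_pos_def_def)
    fix x :: "real ^ 'd" assume "x \<noteq> 0"
    then have pos: "0 < x \<bullet> x" "0 < x \<bullet> (A *v x)"
      using A by (auto simp: sym_pos_def_def)
    have eq: "x \<bullet> (B t *v x) = (1 - t) * (x \<bullet> x) + t * (x \<bullet> (A *v x))"
      by (simp add: B_def matrix_vector_mult_add_rdistrib inner_add_right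
          scaleR_matrix_vector_assoc[symmetric])
    show "0 < x \<bullet> (B t *v x)"
    \<comment> \<open>For \<open>t > 0\<close> the second summand is strictly positive and the first
      nonnegative; at \<open>t = 0\<close> positivity comes from \<open>x \<bullet> x\<close>
      alone.\<close>
    proof (cases "t = 0")
      case True
      with pos show ?thesis unfolding eq by simp
    next
      case False
      with that pos show ?thesis
        unfolding eq by (intro add_nonneg_pos mult_nonneg_nonneg mult_pos_pos) auto
    qed
  qed
  have "continuous_on {0..1} (\<lambda>t. det (B t))"
    unfolding det_def B_def by (auto intro!: continuous_intros)
  moreover assume "\<not> det A > 0"
  moreover have "det (B 0) = 1" "det (B 1) = det A"
    by (simp_all add: B_def)
  ultimately obtain t where "0 \<le> t" "t \<le> 1" "det (B t) = 0"
    using IVT2'[of "\<lambda>t. det (B t)" 1 0 0] by auto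
  with sym_pos_def_invertible[OF B] show False
    by (auto simp: invertible_det_nz)
qed

text \<open>Symmetry passes to the inverse: write \<open>x\<close> as \<open>A\<close> applied to
  \<open>matrix_inv A *v x\<close> and move \<open>A\<close> across the inner product.\<close>

lemma sym_pos_def_inner_matrix_inv:
  fixes A :: "real ^ 'd ^ 'd"
  assumes A: "sym_pos_def A"
  shows "x \<bullet> (matrix_inv A *v y) = (matrix_inv A *v x) \<bullet> y"
proof -
  have inv: "A ** matrix_inv A = mat 1"
    using sym_pos_def_invertible[OF A] unfolding invertible_def matrix_inv_def
    by (rule someI2_ex) blast
  have sym: "(A *v u) \<bullet> v = u \<bullet> (A *v v)" for u v
    using A by (metis dot_lmul_matrix sym_pos_def_def transpose_matrix_vector)
  have "A *v (matrix_inv A *v v) = v" for v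
    by (simp add: matrix_vector_mul_assoc inv)
  then show ?thesis by (metis sym)
qed

section \<open>The Gaussian density, its derivatives and its score\<close>

lemma gaussian_density_has_derivative:
  fixes \<mu> z :: "real ^ 'd"
  assumes S: "sym_pos_def \<Sigma>"
  shows "(gaussian_density \<mu> \<Sigma> has_derivative
    (\<lambda>y. - gaussian_density \<mu> \<Sigma> z * (y \<bullet> (matrix_inv \<Sigma> *v (z - \<mu>))))) (at z)"
proof -
  let ?S = "matrix_inv \<Sigma>" and ?c = "sqrt ((2 * pi) ^ CARD('d) * det \<Sigma>)"
  let ?Q = "\<lambda>z. (z - \<mu>) \<bullet> (?S *v (z - \<mu>))"
  have diff: "((\<lambda>z. z - \<mu>) has_derivative (\<lambda>y. y)) (at z)"
    by (auto intro!: derivative_eq_intros)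
  have "(?Q has_derivative (\<lambda>y. (z - \<mu>) \<bullet> (?S *v y) + y \<bullet> (?S *v (z - \<mu>)))) (at z)"
    by (rule has_derivative_inner[OF diff bounded_linear.has_derivative[OF matrix_vector_mul_bounded_linear diff]])
  \<comment> \<open>Symmetry of the inverse merges the two product rule terms; the resulting factor
    2 cancels the 1/2 in the exponent.\<close>
  moreover have "(z - \<mu>) \<bullet> (?S *v y) = y \<bullet> (?S *v (z - \<mu>))" for y
    by (simp add: sym_pos_def_inner_matrix_inv[OF S, of "z - \<mu>" y] inner_commute)
  ultimately have Q: "(?Q has_derivative (\<lambda>y. 2 * (y \<bullet> (?S *v (z - \<mu>))))) (at z)"
    by simp
  have "((\<lambda>r. exp (- r / 2)) has_real_derivative - exp (- ?Q z / 2) / 2) (at (?Q z))"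
    by (auto intro!: derivative_eq_intros)
  from DERIV_cdivide[OF this, of ?c, THEN has_field_derivative_imp_has_derivative]
  have "((\<lambda>r. exp (- r / 2) / ?c) has_derivative (\<lambda>r. - exp (- ?Q z / 2) / 2 / ?c * r)) (at (?Q z))" .
  from has_derivative_compose[OF Q this] show ?thesis
    by (simp add: gaussian_density_def[abs_def])
qed

lemma vec_upd_has_derivative:
  "(vec_upd z i has_derivative (\<lambda>s. s *\<^sub>R axis i 1)) (at t)"
proof -
  have "vec_upd z i = (\<lambda>t. vec_upd z i 0 + t *\<^sub>R axis i 1)"
    by (auto simp: vec_upd_def vec_eq_iff axis_def)
  moreover have "((\<lambda>t. vec_upd z i 0 + t *\<^sub>R axis i 1) has_derivative (\<lambda>s. s *\<^sub>R axis i 1)) (at t)"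
    by (auto intro!: derivative_eq_intros)
  ultimately show ?thesis by simp
qed

lemma vec_upd_self [simp]: "vec_upd z i (z $ i) = z"
  by (simp add: vec_upd_def vec_eq_iff)

lemma gaussian_density_has_partial_derivative:
  assumes "sym_pos_def \<Sigma>"
  shows "((\<lambda>t. gaussian_density \<mu> \<Sigma> (vec_upd z i t)) has_real_derivative
    - gaussian_density \<mu> \<Sigma> z * (matrix_inv \<Sigma> *v (z - \<mu>)) $ i) (at (z $ i))"
proof -
  have "((\<lambda>t. gaussian_density \<mu> \<Sigma> (vec_upd z i t)) has_derivative
    (\<lambda>s. - gaussian_density \<mu> \<Sigma> z * ((s *\<^sub>R axis i 1) \<bullet> (matrix_inv \<Sigma> *v (z - \<mu>))))) (at (z $ i))"
    by (rule has_derivative_compose[OF vec_upd_has_derivative])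
      (use gaussian_density_has_derivative[OF assms, of \<mu> z] in simp)
  then show ?thesis
    unfolding has_field_derivative_def
    by (rule has_derivative_eq_rhs) (simp add: inner_axis' fun_eq_iff)
qed

text \<open>The exponent is even in \<open>z - \<mu>\<close>. Derivatives in the mean thereby reduce
  to derivatives in the argument.\<close>

lemma gaussian_density_commute: "gaussian_density \<mu> \<Sigma> z = gaussian_density z \<Sigma> \<mu>"
proof -
  have "matrix_inv \<Sigma> *v (z - \<mu>) = - (matrix_inv \<Sigma> *v (\<mu> - z))"
    by (simp add: matrix_vector_mult_diff_distrib)
  then have "(z - \<mu>) \<bullet> (matrix_inv \<Sigma> *v (z - \<mu>)) = - ((z - \<mu>) \<bullet> (matrix_inv \<Sigma> *v (\<mu> - z)))"
    by (simp only: inner_minus_right)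
  also have "\<dots> = (\<mu> - z) \<bullet> (matrix_inv \<Sigma> *v (\<mu> - z))"
    by (simp only: inner_minus_left[symmetric] minus_diff_eq)
  finally show ?thesis
    unfolding gaussian_density_def by (simp only:)
qed

lemma gaussian_density_pos:
  assumes "sym_pos_def \<Sigma>"
  shows "gaussian_density \<mu> \<Sigma> z > 0"
  using sym_pos_def_det_pos[OF assms] by (simp add: gaussian_density_def)

lemma grad_gaussian_density_mean:
  assumes S: "sym_pos_def \<Sigma>"
  shows "grad (\<lambda>m. gaussian_density m \<Sigma> z) \<mu> /\<^sub>R gaussian_density \<mu> \<Sigma> z = matrix_inv \<Sigma> *v (z - \<mu>)"
proof -
  have "deriv (\<lambda>t. gaussian_density (vec_upd \<mu> i t) \<Sigma> z) (\<mu> $ i) =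
      gaussian_density \<mu> \<Sigma> z * (matrix_inv \<Sigma> *v (z - \<mu>)) $ i" for i
    \<comment> \<open>With mean and argument exchanged, the vector is \<open>\<mu> - z\<close>; its
      sign absorbs the minus of the derivative.\<close>
    using DERIV_imp_deriv[OF gaussian_density_has_partial_derivative[OF S, of z \<mu> i]]
    by (simp add: gaussian_density_commute[of _ \<Sigma> z] matrix_vector_mult_diff_distrib
        right_diff_distrib)
  then show ?thesis
    using gaussian_density_pos[OF S, of \<mu> z] by (simp add: grad_def vec_eq_iff)
qed

lemma continuous_on_gaussian_density:
  assumes "sym_pos_def \<Sigma>"
  shows "continuous_on A (gaussian_density \<mu> \<Sigma>)"
  using gaussian_density_has_derivative[OF assms]
  by (meson continuous_at_imp_continuous_on has_derivative_continuous)

lemma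
  fixes f :: "real ^ 'd \<Rightarrow> 'b::{banach, second_countable_topology}"
  assumes S: "sym_pos_def \<Sigma>" and f: "f \<in> borel_measurable borel"
  shows integrable_gaussian_iff: "integrable (gaussian \<mu> \<Sigma>) f \<longleftrightarrow>
      integrable lborel (\<lambda>z. gaussian_density \<mu> \<Sigma> z *\<^sub>R f z)"
    and integral_gaussian: "integral\<^sup>L (gaussian \<mu> \<Sigma>) f = (LINT z|lborel. gaussian_density \<mu> \<Sigma> z *\<^sub>R f z)"
proof -
  have [measurable]: "gaussian_density \<mu> \<Sigma> \<in> borel_measurable borel"
    by (rule borel_measurable_continuous_onI[OF continuous_on_gaussian_density[OF S]])
  have "AE z in lborel. 0 \<le> gaussian_density \<mu> \<Sigma> z"
    using gaussian_density_pos[OF S] by (auto intro: less_imp_le)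
  with f show "integrable (gaussian \<mu> \<Sigma>) f \<longleftrightarrow>
      integrable lborel (\<lambda>z. gaussian_density \<mu> \<Sigma> z *\<^sub>R f z)"
    and "integral\<^sup>L (gaussian \<mu> \<Sigma>) f = (LINT z|lborel. gaussian_density \<mu> \<Sigma> z *\<^sub>R f z)"
    unfolding gaussian_def by (simp_all add: integrable_density integral_density)
qed

section \<open>Stein's identity and the gradient in the mean\<close>

lemma integral_grad_gaussian:
  fixes h :: "real ^ 'd \<Rightarrow> real"
  assumes ACL: "locally_ACL h" and cont: "continuous_on UNIV h" and S: "sym_pos_def \<Sigma>"
    and h: "integrable (gaussian \<mu> \<Sigma>) h"
    and grad: "integrable (gaussian \<mu> \<Sigma>) (grad h)"
    and score: "integrable (gaussian \<mu> \<Sigma>) (\<lambda>z. h z *\<^sub>R (matrix_inv \<Sigma> *v (z - \<mu>)))"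
  shows "(LINT z|gaussian \<mu> \<Sigma>. grad h z) =
    (LINT z|gaussian \<mu> \<Sigma>. h z *\<^sub>R (matrix_inv \<Sigma> *v (z - \<mu>)))"
proof -
  let ?q = "gaussian_density \<mu> \<Sigma>" and ?s = "\<lambda>z. matrix_inv \<Sigma> *v (z - \<mu>)"
  have [measurable]: "h \<in> borel_measurable borel"
    by (rule borel_measurable_continuous_onI[OF cont])
  \<comment> \<open>A density does not change the measurable sets, so Borel measurability of the
    gradient can be read off from its integrability.\<close>
  have [simp]: "borel_measurable (gaussian \<mu> \<Sigma>) = borel_measurable borel"
    by (intro measurable_cong_sets) (simp_all add: gaussian_def)
  have grad_meas: "grad h \<in> borel_measurable borel"
    and score_meas: "(\<lambda>z. h z *\<^sub>R ?s z) \<in> borel_measurable borel"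
    using borel_measurable_integrable[OF grad] borel_measurable_integrable[OF score] by simp_all
  have h_q: "integrable lborel (\<lambda>z. h z * ?q z)"
    using h by (simp add: integrable_gaussian_iff[OF S] mult.commute)
  have grad_q: "integrable lborel (\<lambda>z. ?q z *\<^sub>R grad h z)"
    using grad by (simp add: integrable_gaussian_iff[OF S] grad_meas)
  have score_q: "integrable lborel (\<lambda>z. ?q z *\<^sub>R h z *\<^sub>R ?s z)"
    using score integrable_gaussian_iff[OF S score_meas] by simp
  have cont_s: "continuous_on UNIV ?s"
    by (intro bounded_linear.continuous_on[OF matrix_vector_mul_bounded_linear] continuous_intros)
  have "(LINT z|lborel. ?q z *\<^sub>R grad h z - ?q z *\<^sub>R h z *\<^sub>R ?s z) $ i = 0" for i
  proof -
    have int: "integrable lborel (\<lambda>z. ?q z *\<^sub>R grad h z - ?q z *\<^sub>R h z *\<^sub>R ?s z)"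
      using grad_q score_q by (rule Bochner_Integration.integrable_diff)
    \<comment> \<open>As the \<open>i\<close>-th partial derivative of \<open>?q\<close> is
      \<open>- ?q z * ?s z $ i\<close>, the right-hand side is the product rule expression for the
      partial derivative of \<open>h * ?q\<close>.\<close>
    have comp: "(?q z *\<^sub>R grad h z - ?q z *\<^sub>R h z *\<^sub>R ?s z) $ i =
        grad h z $ i * ?q z + h z * (- ?q z * ?s z $ i)" for z
      by (simp add: algebra_simps)
    have "(LINT z|lborel. ?q z *\<^sub>R grad h z - ?q z *\<^sub>R h z *\<^sub>R ?s z) $ i =
        (LINT z|lborel. grad h z $ i * ?q z + h z * (- ?q z * ?s z $ i))"
      unfolding comp[symmetric] by (rule integral_bounded_linear[OF bounded_linear_vec_nth int, symmetric])
    also have "\<dots> = 0"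
    proof (rule integral_partial_derivative_product_eq_0[OF ACL grad_meas _ _ h_q])
      show "((\<lambda>t. ?q (vec_upd z i t)) has_real_derivative - ?q z * ?s z $ i) (at (z $ i))" for z
        by (rule gaussian_density_has_partial_derivative[OF S])
      show "continuous_on UNIV (\<lambda>z. - ?q z * ?s z $ i)"
        using continuous_on_gaussian_density[OF S] cont_s by (intro continuous_intros)
      show "integrable lborel (\<lambda>z. grad h z $ i * ?q z + h z * (- ?q z * ?s z $ i))"
        unfolding comp[symmetric] by (rule integrable_bounded_linear[OF bounded_linear_vec_nth int])
    qed
    finally show ?thesis .
  qed
  then have "(LINT z|lborel. ?q z *\<^sub>R grad h z - ?q z *\<^sub>R h z *\<^sub>R ?s z) = 0"
    by (simp add: vec_eq_iff)
  then show ?thesis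
    using grad_q score_q
    by (simp only: integral_gaussian[OF S grad_meas] integral_gaussian[OF S score_meas]
        Bochner_Integration.integral_diff right_minus_eq)
qed

theorem theorem3:
  fixes h :: "real ^ 'd \<Rightarrow> real" and \<mu> :: "real ^ 'd" and \<Sigma> :: "real ^ 'd ^ 'd"
  assumes "locally_ACL h"
    and "continuous_on UNIV h"
    and "sym_pos_def \<Sigma>"
    and "integrable (gaussian \<mu> \<Sigma>) h"
    and "integrable (gaussian \<mu> \<Sigma>) (grad h)"
    and "integrable (gaussian \<mu> \<Sigma>) (\<lambda>z. h z *\<^sub>R (matrix_inv \<Sigma> *v (z - \<mu>)))"
    and interchange:
      "has_grad (\<lambda>m. LINT z|gaussian m \<Sigma>. h z) \<mu>
         (LINT z|gaussian \<mu> \<Sigma>. h z *\<^sub>R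
            (grad (\<lambda>m. gaussian_density m \<Sigma> z) \<mu> /\<^sub>R gaussian_density \<mu> \<Sigma> z))"
  shows "has_grad (\<lambda>m. LINT z|gaussian m \<Sigma>. h z) \<mu> (LINT z|gaussian \<mu> \<Sigma>. grad h z) \<and>
         grad (\<lambda>m. LINT z|gaussian m \<Sigma>. h z) \<mu> = (LINT z|gaussian \<mu> \<Sigma>. grad h z) \<and>
         (LINT z|gaussian \<mu> \<Sigma>. grad h z) =
           (LINT z|gaussian \<mu> \<Sigma>. h z *\<^sub>R (matrix_inv \<Sigma> *v (z - \<mu>)))"
proof -
  have stein: "(LINT z|gaussian \<mu> \<Sigma>. grad h z) =
      (LINT z|gaussian \<mu> \<Sigma>. h z *\<^sub>R (matrix_inv \<Sigma> *v (z - \<mu>)))"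
    by (rule integral_grad_gaussian[OF assms(1-6)])
  \<comment> \<open>Once the quotient is recognised as the score, the vector in
    \<open>interchange\<close> is the right-hand side of \<open>stein\<close>.\<close>
  have hg: "has_grad (\<lambda>m. LINT z|gaussian m \<Sigma>. h z) \<mu> (LINT z|gaussian \<mu> \<Sigma>. grad h z)"
    using interchange unfolding grad_gaussian_density_mean[OF assms(3)] stein .
  \<comment> \<open>Each partial derivative exists by \<open>has_grad\<close>, so
    \<open>deriv\<close> returns its unique value instead of an unspecified one.\<close>
  have "grad f m = G" if "has_grad f m G" for f and m G :: "real ^ 'd"
    using that by (simp add: has_grad_def grad_def vec_eq_iff DERIV_imp_deriv)
  with hg stein show ?thesis by blast
qed

end
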